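(* Let $f(z)=z+\sum_{n=2}^{\infty}a_nz^n$ belong to the class $\mathcal{SL}^*$. Then the third Hankel determinant $$H_3(1)=\begin{vmatrix} 1 & a_2 & a_3\\ a_2 & a_3 & a_4\\ a_3 & a_4 & a_5\end{vmatrix}=a_3(a_2a_4-a_3^2)-a_4(a_4-a_2a_3)+a_5(a_3-a_2^2)$$ satisfies $$|H_3(1)|\le \frac{1}{36}.$$ The bound is sharp, i.e. there exists a function $f\in\mathcal{SL}^*$ for which $|H_3(1)|=\frac1{36}$.
   Context: $\Delta=\{z\in\mathbb{C}:|z|<1\}$ is the open unit disk. $\mathcal{A}$ is the class of analytic functions on $\Delta$ of the form $f(z)=z+\sum_{n=2}^{\infty}a_nz^n$ (so $a_1=1$). For analytic functions $F,G$ on $\Delta$, $F$ is subordinate to $G$, written $F\prec G$, if there is an analytic function $\omega:\Delta\to\mathbb{C}$ with $\omega(0)=0$ and $|\omega(z)|<1$ for $z\in\Delta$ such that $F(z)=G(\omega(z))$ for all $z\in\Delta$. The class $\mathcal{SL}^*$ is $$\mathcal{SL}^*=\left\{f\in\mathcal{A}:\ \frac{zf'(z)}{f(z)}\prec\sqrt{1+z},\ z\in\Delta\right\},$$ where $\sqrt{\cdot}$ is the principal branch (value $1$ at $z=0$), and $zf'(z)/f(z)$ is understood to take the value $1$ at $z=0$. *)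

theory Defs
  imports "HOL-Complex_Analysis.Complex_Analysis"
begin

abbreviation unit_disk :: "complex set" (\<open>\<Delta>\<close>)
  where "\<Delta> \<equiv> ball 0 1"

definition taylor_coeff :: "(complex \<Rightarrow> complex) \<Rightarrow> nat \<Rightarrow> complex"
  where "taylor_coeff f n = fps_nth (fps_expansion f 0) n"

text \<open>The summand of index \<open>n\<close> is \<open>a\<^sub>k z\<^sup>k\<close> with \<open>k = n + 2\<close>, so the
  condition reads \<open>f(z) = z + \<Sum>\<^sub>k\<^sub>\<ge>\<^sub>2 a\<^sub>k z\<^sup>k\<close> on the disk.
  Functions are total; only their values on the disk are constrained.\<close>

definition class_A :: "(complex \<Rightarrow> complex) set"
  where "class_A = {f. f holomorphic_on \<Delta> \<and>
    (\<forall>z\<in>\<Delta>. (\<lambda>n. taylor_coeff f (n + 2) * z ^ (n + 2)) sums (f z - z))}"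

definition subordinate :: "(complex \<Rightarrow> complex) \<Rightarrow> (complex \<Rightarrow> complex) \<Rightarrow> bool"
    (infix \<open>\<prec>\<^sub>s\<close> 50)
  where "F \<prec>\<^sub>s G \<longleftrightarrow> F holomorphic_on \<Delta> \<and> G holomorphic_on \<Delta> \<and>
    (\<exists>\<omega>. \<omega> holomorphic_on \<Delta> \<and> \<omega> 0 = 0 \<and> (\<forall>z\<in>\<Delta>. norm (\<omega> z) < 1) \<and>
      (\<forall>z\<in>\<Delta>. F z = G (\<omega> z)))"

text \<open>\<open>z f'(z) / f(z)\<close>, with the removable singularity at \<open>0\<close> filled in.\<close>

definition log_deriv_quot :: "(complex \<Rightarrow> complex) \<Rightarrow> complex \<Rightarrow> complex"
  where "log_deriv_quot f z = (if z = 0 then 1 else z * deriv f z / f z)"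

text \<open>At a zero \<open>z \<noteq> 0\<close> of \<open>f\<close> the quotient has the value \<open>0\<close> by the convention \<open>x / 0 = 0\<close>.
  This admits no spurious members: \<open>csqrt (1 + w) \<noteq> 0\<close> whenever \<open>norm w < 1\<close>, so the subordination
  forces \<open>f\<close> to have no zero in the punctured disk.\<close>

definition class_SL :: "(complex \<Rightarrow> complex) set"
  where "class_SL = {f \<in> class_A. log_deriv_quot f \<prec>\<^sub>s (\<lambda>z. csqrt (1 + z))}"

definition hankel_matrix_3_1 :: "(complex \<Rightarrow> complex) \<Rightarrow> complex^3^3"
  where "hankel_matrix_3_1 f =
    (let a = taylor_coeff f in vector
      [vector [1,   a 2, a 3],
       vector [a 2, a 3, a 4],
       vector [a 3, a 4, a 5]])"

definition H_3_1 :: "(complex \<Rightarrow> complex) \<Rightarrow> complex"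
  where "H_3_1 f = det (hankel_matrix_3_1 f)"

lemma class_A_iff:
  "f \<in> class_A \<longleftrightarrow> f holomorphic_on \<Delta> \<and> f 0 = 0 \<and> deriv f 0 = 1"
proof (cases "f holomorphic_on \<Delta>")
  case hol: True
  have split: "(\<lambda>n. taylor_coeff f (n + 2) * z ^ (n + 2)) sums (f z - (f 0 + deriv f 0 * z))"
    if "z \<in> \<Delta>" for z
  proof -
    have "(\<lambda>n. (deriv ^^ n) f 0 / fact n * (z - 0) ^ n) sums f z"
      by (rule holomorphic_power_series[OF hol that])
    then have "(\<lambda>n. taylor_coeff f n * z ^ n) sums f z"
      by (simp add: taylor_coeff_def fps_expansion_def)
    then have "(\<lambda>n. taylor_coeff f (n + 2) * z ^ (n + 2)) sums
        (f z - (\<Sum>i<2. taylor_coeff f i * z ^ i))"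
      by (subst sums_iff_shift) simp
    then show ?thesis
      by (simp add: taylor_coeff_def fps_expansion_def numeral_2_eq_2)
  qed
  have "f 0 = 0 \<and> deriv f 0 = 1" if A: "f \<in> class_A"
  proof -
    have eq: "f 0 + deriv f 0 * z = z" if "z \<in> \<Delta>" for z
    proof -
      have "(\<lambda>n. taylor_coeff f (n + 2) * z ^ (n + 2)) sums (f z - z)"
        using A that unfolding class_A_def by blast
      from sums_unique2[OF this split[OF that]] show ?thesis
        by (simp add: algebra_simps)
    qed
    show ?thesis
      using eq[of 0] eq[of "1/2"] by simp
  qed
  moreover have "f \<in> class_A" if "f 0 = 0 \<and> deriv f 0 = 1"
    using split that hol by (simp add: class_A_def)
  ultimately show ?thesis using hol by blast
qed (simp add: class_A_def)

lemma class_SL_nonzero: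
  assumes "f \<in> class_SL" "z \<in> \<Delta>" "z \<noteq> 0"
  shows "f z \<noteq> 0"
proof
  assume "f z = 0"
  then have "log_deriv_quot f z = 0"
    using assms by (simp add: log_deriv_quot_def)
  moreover obtain \<omega> where "norm (\<omega> z) < 1" "log_deriv_quot f z = csqrt (1 + \<omega> z)"
    using assms unfolding class_SL_def subordinate_def by blast
  ultimately have w: "norm (\<omega> z) < 1" "csqrt (1 + \<omega> z) = 0" by simp_all
  then have "1 + \<omega> z = 0"
    by (simp only: csqrt_eq_0)
  then have "\<omega> z = -1"
    by (simp add: add_eq_0_iff)
  with w show False by simp
qed

end

theory Submission
  imports Defs
begin

text \<open>Write \<open>(z f')\<^sup>2 = f\<^sup>2 (1 + \<omega>)\<close> with a Schwarz function \<open>\<omega> = c\<^sub>1 z + c\<^sub>2 z\<^sup>2 + \<dots>\<close>; comparing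
  coefficients turns the Hankel determinant into a polynomial in \<open>c\<^sub>1, \<dots>, c\<^sub>4\<close>.
  The Schur algorithm expresses the \<open>c\<^sub>i\<close> by free parameters \<open>a, x, y, w\<close> in the closed disk.
  Even with the triangle inequality applied to every monomial, the resulting real polynomial in
  \<open>\<bar>a\<bar>, \<bar>x\<bar>, \<bar>y\<bar>\<close> is at most the required bound, attained at \<open>a = x = 0\<close>, \<open>\<bar>y\<bar> = 1\<close>, that is for
  \<open>\<omega>(z) = z\<^sup>3\<close>.\<close>

section \<open>Schur class and one step of the Schur algorithm\<close>

text \<open>The bound is weak because dividing a rotation by \<open>z\<close> leaves a unimodular
  constant.\<close>

definition schur_class :: "(complex \<Rightarrow> complex) set"
  where "schur_class = {\<phi>. \<phi> holomorphic_on \<Delta> \<and> (\<forall>z\<in>\<Delta>. norm (\<phi> z) \<le> 1)}"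

text \<open>The removable singularity of \<open>\<omega> z / z\<close> is filled with the derivative
  at \<open>0\<close>. Both parts of the Schwarz lemma are needed for the bound: growth away from
  \<open>0\<close>, and the derivative estimate at \<open>0\<close>.\<close>

lemma schwarz_quotient:
  assumes "\<omega> holomorphic_on \<Delta>" "\<omega> 0 = 0" "\<And>z. z \<in> \<Delta> \<Longrightarrow> norm (\<omega> z) < 1"
  obtains \<phi> where "\<phi> \<in> schur_class" "\<And>z. z \<in> \<Delta> \<Longrightarrow> \<omega> z = z * \<phi> z"
proof -
  obtain \<phi> where \<phi>: "\<phi> holomorphic_on \<Delta>" "\<And>z. norm z < 1 \<Longrightarrow> \<omega> z = z * \<phi> z" "deriv \<omega> 0 = \<phi> 0"
    using Schwarz3[OF assms(1,2)] by blast
  have "norm (\<phi> z) \<le> 1" if z: "norm z < 1" for z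
  proof (cases "z = 0")
    case True
    have "norm (deriv \<omega> 0) \<le> 1"
      by (rule Schwarz_Lemma(2)[of _ 0]) (use assms in auto)
    then show ?thesis
      using True \<phi>(3) by simp
  next
    case False
    have "norm (\<omega> z) \<le> norm z"
      by (rule Schwarz_Lemma(1)) (use assms z in auto)
    then show ?thesis
      using False \<phi>(2)[OF z] by (simp add: norm_mult mult_le_cancel_left1)
  qed
  then show thesis
    using that[of \<phi>] \<phi> by (auto simp: schur_class_def)
qed

text \<open>This is the inverse disk automorphism \<open>\<phi> = (\<phi> 0 + z \<psi>) / (1 + cnj
  (\<phi> 0) z \<psi>)\<close> with the denominator cleared. In this form it also covers unimodular
  constants and can be compared coefficientwise as an identity of power series.\<close>

lemma schur_step:
  assumes "\<phi> \<in> schur_class"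
  obtains \<psi> where "\<psi> \<in> schur_class"
    "\<And>z. z \<in> \<Delta> \<Longrightarrow> \<phi> z * (1 + cnj (\<phi> 0) * (z * \<psi> z)) = \<phi> 0 + z * \<psi> z"
proof (cases "\<exists>\<xi>\<in>\<Delta>. norm (\<phi> \<xi>) = 1")
  case True
  then obtain \<xi> where \<xi>: "\<xi> \<in> \<Delta>" "norm (\<phi> \<xi>) = 1" by blast
  have "\<phi> constant_on \<Delta>"
    by (rule maximum_modulus_principle[of _ _ "\<Delta>" \<xi>]) (use assms \<xi> in \<open>auto simp: schur_class_def\<close>)
  then have const: "\<phi> z = \<phi> 0" if "z \<in> \<Delta>" for z
    using that by (fastforce simp: constant_on_def)
  show thesis
  \<comment> \<open>By the maximum principle \<open>\<phi>\<close> is constant here, so the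
    algorithm stops with \<open>\<psi> = 0\<close>.\<close>
  proof (rule that[of "\<lambda>_. 0"])
    show "\<phi> z * (1 + cnj (\<phi> 0) * (z * 0)) = \<phi> 0 + z * 0" if "z \<in> \<Delta>" for z
      using const[OF that] by simp
  qed (simp add: schur_class_def)
next
  case False
  then have lt1: "norm (\<phi> z) < 1" if "z \<in> \<Delta>" for z
    using assms that by (auto simp: schur_class_def order.order_iff_strict)
  \<comment> \<open>The automorphism of the disk that moves \<open>\<phi> 0\<close> to
    \<open>0\<close> turns \<open>\<phi>\<close> into a Schwarz function, which can be divided by
    \<open>z\<close>.\<close>
  define g where "g = Moebius_function 0 (\<phi> 0) \<circ> \<phi>"
  have "g holomorphic_on \<Delta>"
    unfolding g_def
  proof (rule holomorphic_on_compose_gen)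
    show "\<phi> holomorphic_on \<Delta>"
      using assms by (simp add: schur_class_def)
    show "Moebius_function 0 (\<phi> 0) holomorphic_on \<Delta>"
      using lt1[of 0] by (intro Moebius_function_holomorphic) simp
    show "\<phi> ` \<Delta> \<subseteq> \<Delta>"
      using lt1 by auto
  qed
  moreover have "g 0 = 0"
    by (simp add: g_def Moebius_function_eq_zero)
  moreover have "norm (g z) < 1" if "z \<in> \<Delta>" for z
    using lt1 that by (simp add: g_def Moebius_function_norm_lt_1)
  ultimately obtain \<psi> where \<psi>: "\<psi> \<in> schur_class" "\<And>z. z \<in> \<Delta> \<Longrightarrow> g z = z * \<psi> z"
    using schwarz_quotient[of g] by blast
  have "\<phi> z * (1 + cnj (\<phi> 0) * (z * \<psi> z)) = \<phi> 0 + z * \<psi> z" if z: "z \<in> \<Delta>" for z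
  proof -
    have "norm (cnj (\<phi> 0) * \<phi> z) < 1"
      using norm_mult_less[of "cnj (\<phi> 0)" 1 "\<phi> z" 1] lt1[OF z] lt1[of 0] by simp
    then have "1 - cnj (\<phi> 0) * \<phi> z \<noteq> 0"
      by auto
    then show ?thesis
      unfolding \<psi>(2)[OF z, symmetric] g_def
      by (simp add: Moebius_function_simple field_simps)
  qed
  with \<psi>(1) that show thesis by blast
qed

section \<open>Taylor coefficients of a Schwarz function in Schur parameters\<close>

lemma has_fps_expansion_disk:
  assumes "f holomorphic_on \<Delta>"
  shows "f has_fps_expansion fps_expansion f 0"
  by (rule has_fps_expansion_fps_expansion[OF _ _ assms]) auto

lemma fps_expansion_eq_disk:
  assumes "f has_fps_expansion F" "g has_fps_expansion G" "\<And>z. z \<in> \<Delta> \<Longrightarrow> f z = g z"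
  shows "F = G"
proof -
  have "eventually (\<lambda>z. z \<in> \<Delta>) (nhds (0::complex))"
    by (rule eventually_nhds_in_open) auto
  then have "eventually (\<lambda>z. f z = g z) (nhds 0)"
    by eventually_elim (use assms(3) in auto)
  then have "g has_fps_expansion F"
    using assms(1) has_fps_expansion_cong[of f g F F] by simp
  then show ?thesis
    using assms(2) fps_expansion_unique_complex by blast
qed

text \<open>Comparing coefficients in the identity of \<open>schur_step\<close> gives each
  \<open>p n\<close> in terms of \<open>q\<close> and earlier \<open>p\<close>; substituting the
  earlier ones produces the common factor \<open>1 - a * cnj a\<close>. Indices up to
  \<open>3\<close> suffice, since the coefficients of \<omega> are shifted by one and only
  \<open>c 1\<close> to \<open>c 4\<close> enter the determinant.\<close>

lemma schur_step_coeffs: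
  assumes "\<phi> \<in> schur_class"
  defines "p \<equiv> fps_nth (fps_expansion \<phi> 0)"
  obtains \<psi> q where "\<psi> \<in> schur_class" "q = fps_nth (fps_expansion \<psi> 0)" "norm (p 0) \<le> 1"
    "p 1 = of_real (1 - norm (p 0) ^ 2) * q 0"
    "p 2 = of_real (1 - norm (p 0) ^ 2) * (q 1 - cnj (p 0) * q 0 ^ 2)"
    "p 3 = of_real (1 - norm (p 0) ^ 2) * (q 2 - 2 * cnj (p 0) * q 0 * q 1 + cnj (p 0) ^ 2 * q 0 ^ 3)"
proof -
  obtain \<psi> where \<psi>: "\<psi> \<in> schur_class"
      "\<And>z. z \<in> \<Delta> \<Longrightarrow> \<phi> z * (1 + cnj (\<phi> 0) * (z * \<psi> z)) = \<phi> 0 + z * \<psi> z"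
    using schur_step[OF assms(1)] by blast
  define q where "q = fps_nth (fps_expansion \<psi> 0)"
  define F where "F = fps_expansion \<phi> 0"
  define G where "G = fps_expansion \<psi> 0"
  define a where "a = \<phi> 0"
  have F: "\<phi> has_fps_expansion F" and G: "\<psi> has_fps_expansion G"
    using assms(1) \<psi>(1) by (auto simp: schur_class_def F_def G_def intro: has_fps_expansion_disk)
  have eq: "F * (1 + fps_const (cnj a) * (fps_X * G)) = fps_const a + fps_X * G"
    by (rule fps_expansion_eq_disk[OF _ _ \<psi>(2)]) (auto simp: a_def intro!: fps_expansion_intros F G)
  have nth: "fps_nth F n = p n" "fps_nth G n = q n" for n
    by (auto simp: F_def G_def p_def q_def)
  have e: "fps_nth (F * (1 + fps_const (cnj a) * (fps_X * G))) n = fps_nth (fps_const a + fps_X * G) n" for n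
    by (simp add: eq)
  have p0: "p 0 = a"
    using e[of 0] by (simp add: nth)
  have s: "complex_of_real (1 - norm a ^ 2) = 1 - a * cnj a"
    by (simp only: of_real_diff complex_norm_square of_real_1)
  have "p 1 = q 0 - cnj a * (a * q 0)"
    using e[of 1] p0 by (simp add: nth fps_mult_nth algebra_simps)
  then have p1: "p 1 = (1 - a * cnj a) * q 0"
    by (simp add: algebra_simps)
  have p2': "p 2 = q 1 - cnj a * (a * q 1 + p 1 * q 0)"
    using e[of 2] p0 by (simp add: nth fps_mult_nth numeral_2_eq_2 algebra_simps)
  have p2: "p 2 = (1 - a * cnj a) * (q 1 - cnj a * q 0 ^ 2)"
    unfolding p2' p1 by (simp add: power2_eq_square algebra_simps)
  have p3': "p 3 = q 2 - cnj a * (a * q 2 + p 1 * q 1 + p 2 * q 0)"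
    using e[of 3] p0 by (simp add: nth fps_mult_nth numeral_2_eq_2 numeral_3_eq_3 algebra_simps)
  have p3: "p 3 = (1 - a * cnj a) * (q 2 - 2 * cnj a * q 0 * q 1 + cnj a ^ 2 * q 0 ^ 3)"
    unfolding p3' p2 p1 by (simp add: power2_eq_square power3_eq_cube algebra_simps)
  have "norm a \<le> 1"
    using assms(1) by (simp add: a_def schur_class_def)
  then show thesis
    using that[OF \<psi>(1) q_def] p1 p2 p3 by (simp only: p0 s)
qed

text \<open>After division by \<open>z\<close>, three Schur steps are nested. The parameters
  \<open>a\<close>, \<open>x\<close>, \<open>y\<close>, \<open>w\<close> are the values at
  \<open>0\<close> of the four successive Schur functions, and each step uses one coefficient fewer
  than the one before.\<close>

lemma schwarz_coeffs:
  assumes "\<omega> holomorphic_on \<Delta>" "\<omega> 0 = 0" "\<And>z. z \<in> \<Delta> \<Longrightarrow> norm (\<omega> z) < 1"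
  defines "c \<equiv> fps_nth (fps_expansion \<omega> 0)"
  obtains a x y w S X Y where "norm a \<le> 1" "norm x \<le> 1" "norm y \<le> 1" "norm w \<le> 1"
    "S = 1 - norm a ^ 2" "X = 1 - norm x ^ 2" "Y = 1 - norm y ^ 2"
    "c 0 = 0" "c 1 = a" "c 2 = of_real S * x" "c 3 = of_real S * (of_real X * y - cnj a * x ^ 2)"
    "c 4 = of_real S * (of_real X * (of_real Y * w - cnj x * y ^ 2)
       - 2 * cnj a * x * of_real X * y + cnj a ^ 2 * x ^ 3)"
proof -
  obtain \<phi> where \<phi>: "\<phi> \<in> schur_class" "\<And>z. z \<in> \<Delta> \<Longrightarrow> \<omega> z = z * \<phi> z"
    using schwarz_quotient assms(1-3) by blast
  define p where "p = fps_nth (fps_expansion \<phi> 0)"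
  obtain \<psi> q where \<psi>: "\<psi> \<in> schur_class" and q: "q = fps_nth (fps_expansion \<psi> 0)"
    and p: "norm (p 0) \<le> 1" "p 1 = of_real (1 - norm (p 0) ^ 2) * q 0"
    "p 2 = of_real (1 - norm (p 0) ^ 2) * (q 1 - cnj (p 0) * q 0 ^ 2)"
    "p 3 = of_real (1 - norm (p 0) ^ 2)
      * (q 2 - 2 * cnj (p 0) * q 0 * q 1 + cnj (p 0) ^ 2 * q 0 ^ 3)"
    using schur_step_coeffs[OF \<phi>(1)] unfolding p_def by blast
  obtain \<psi>' r where \<psi>': "\<psi>' \<in> schur_class" and r: "r = fps_nth (fps_expansion \<psi>' 0)"
    and q': "norm (q 0) \<le> 1" "q 1 = of_real (1 - norm (q 0) ^ 2) * r 0"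
    "q 2 = of_real (1 - norm (q 0) ^ 2) * (r 1 - cnj (q 0) * r 0 ^ 2)"
    using schur_step_coeffs[OF \<psi>] unfolding q by blast
  obtain \<theta> t where \<theta>: "\<theta> \<in> schur_class" and t: "t = fps_nth (fps_expansion \<theta> 0)"
    and r': "norm (r 0) \<le> 1" "r 1 = of_real (1 - norm (r 0) ^ 2) * t 0"
    using schur_step_coeffs[OF \<psi>'] unfolding r by blast
  \<comment> \<open>Only the bound on the constant coefficient is taken from this further
    application.\<close>
  have t0: "norm (t 0) \<le> 1"
    using schur_step_coeffs[OF \<theta>] unfolding t by blast
  have "fps_expansion \<omega> 0 = fps_X * fps_expansion \<phi> 0"
    by (rule fps_expansion_eq_disk[OF _ _ \<phi>(2)])
       (use assms(1) \<phi>(1) in \<open>auto simp: schur_class_def intro!: fps_expansion_intros has_fps_expansion_disk\<close>)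
  then have c: "c n = (if n = 0 then 0 else p (n - 1))" for n
    by (simp add: c_def p_def)
  show thesis
    by (rule that[OF p(1) q'(1) r'(1) t0 refl refl refl])
       (auto simp: c p(2-)[unfolded One_nat_def] q'(2-)[unfolded One_nat_def] r'(2-)[unfolded One_nat_def]
          simp del: of_real_diff of_real_power of_real_1)
qed

section \<open>Estimate of the Hankel polynomial\<close>

text \<open>The left side is the triangle-inequality majorant of the Hankel polynomial, scaled by
  \<open>36864\<close>; \<open>c\<close>, \<open>x\<close>, \<open>y\<close> stand for the moduli of
  the first three Schur parameters, and the fourth is already bounded by \<open>1\<close>. Equality
  occurs at \<open>c = x = 0\<close>, \<open>y = 1\<close>.\<close>

lemma real_bound:
  fixes c x y S X Y :: real
  assumes c: "0 \<le> c" "c \<le> 1" and x: "0 \<le> x" "x \<le> 1" and y: "0 \<le> y" "y \<le> 1"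
    and S: "S = 1 - c ^ 2" and X: "X = 1 - x ^ 2" and Y: "Y = 1 - y ^ 2"
  shows "29 * c ^ 6 + 116 * c ^ 4 * S * x + (80 * c ^ 2 * S ^ 2 + 112 * c ^ 4 * S) * x ^ 2
    + (576 * S ^ 3 + 1216 * c ^ 2 * S ^ 2 + 864 * c ^ 4 * S) * x ^ 3 + 128 * c ^ 2 * S ^ 2 * x ^ 4
    + S * X * ((112 * c ^ 3 + (1216 * S + 1728 * c ^ 2) * (c * x) + 256 * S * c * x ^ 2) * y
      + (1024 * S * X + 1152 * S * x ^ 2 + 864 * c ^ 2 * x) * y ^ 2
      + (1152 * S * x + 864 * c ^ 2) * Y) \<le> 1024"
proof -
  define u v t where "u = c ^ 2" and "v = x ^ 2" and "t = y ^ 2"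
  have rng: "0 \<le> u" "0 \<le> v" "0 \<le> t" "0 \<le> 1 - u" "0 \<le> 1 - v" "0 \<le> 1 - t"
    using c x y by (auto simp: u_def v_def t_def power_le_one)
  have S': "S = 1 - u" and X': "X = 1 - v" and Y': "Y = 1 - t"
    by (auto simp: S X Y u_def v_def t_def)
  have SX: "0 \<le> S" "0 \<le> X"
    using rng by (auto simp: S' X')
  have c_le: "c \<le> (1 + u) / 2"
    using sum_squares_bound[of c 1] by (simp add: u_def)
  have x_le: "x \<le> (1 + v) / 2"
    using sum_squares_bound[of x 1] by (simp add: v_def)
  have y_le: "y \<le> (1 + t) / 2"
    using sum_squares_bound[of y 1] by (simp add: t_def)
  \<comment> \<open>The weights are deliberately unequal. With \<open>(u + v) / 2\<close> instead,
    the majorant at \<open>u = 0\<close>, \<open>t = 1\<close> would be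
    \<open>1024 + 128 * v - 576 * v ^ 2\<close>, too large for small positive
    \<open>v\<close>.\<close>
  have cx_le: "c * x \<le> u + v / 4"
    using sum_squares_bound[of c "x / 2"] by (simp add: u_def v_def power_divide)
  have pow: "c ^ 3 = u * c" "c ^ 4 = u ^ 2" "c ^ 6 = u ^ 3" "x ^ 3 = v * x" "x ^ 4 = v ^ 2"
    by (simp_all add: u_def v_def power_mult[symmetric] power_numeral_reduce)
  text \<open>Replacing odd powers by these bounds makes the estimate affine in \<open>t\<close>, so only \<open>t = 0\<close>
    and \<open>t = 1\<close> remain; there the slack has nonnegative Bernstein coefficients in \<open>u\<close> and \<open>v\<close>.\<close>
  define B where "B = 29 * u ^ 3 + 116 * u ^ 2 * S * ((1 + v) / 2) + (80 * u * S ^ 2 + 112 * u ^ 2 * S) * v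
    + (576 * S ^ 3 + 1216 * u * S ^ 2 + 864 * u ^ 2 * S) * (v * ((1 + v) / 2)) + 128 * u * S ^ 2 * v ^ 2"
  define Q where "Q = 112 * (u * ((1 + u) / 2)) + (1216 * S + 1728 * u) * (u + v / 4) + 256 * S * ((1 + u) / 2) * v"
  define P where "P = 1024 * S * X + 1152 * S * v + 864 * u * ((1 + v) / 2)"
  define R where "R = 1152 * S * ((1 + v) / 2) + 864 * u"
  have "29 * c ^ 6 + 116 * c ^ 4 * S * x + (80 * c ^ 2 * S ^ 2 + 112 * c ^ 4 * S) * x ^ 2
    + (576 * S ^ 3 + 1216 * c ^ 2 * S ^ 2 + 864 * c ^ 4 * S) * x ^ 3 + 128 * c ^ 2 * S ^ 2 * x ^ 4
    + S * X * ((112 * c ^ 3 + (1216 * S + 1728 * c ^ 2) * (c * x) + 256 * S * c * x ^ 2) * y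
      + (1024 * S * X + 1152 * S * x ^ 2 + 864 * c ^ 2 * x) * y ^ 2
      + (1152 * S * x + 864 * c ^ 2) * Y) \<le> B + S * X * (Q * ((1 + t) / 2) + P * t + R * (1 - t))"
    unfolding pow u_def[symmetric] v_def[symmetric] t_def[symmetric] B_def Q_def P_def R_def Y'
    by (intro add_mono mult_mono mult_nonneg_nonneg add_nonneg_nonneg order_refl c_le x_le y_le cx_le)
       (use rng SX c x y in auto)
  also have "\<dots> = t * (B + S * X * (P + Q)) + (1 - t) * (B + S * X * (R + Q / 2))"
    by (simp add: field_simps)
  also have "\<dots> \<le> t * 1024 + (1 - t) * 1024"
  proof (intro add_mono mult_left_mono)
    \<comment> \<open>The case \<open>t = 1\<close>. No term \<open>(1-u)^3 * (1-v)^2\<close>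
      appears, because the slack vanishes at the extremal point \<open>u = v = 0\<close>.\<close>
    have "1024 - (B + S * X * (P + Q)) =
        (1-u)^3 * (176 * v * (1-v) + 448 * v^2)
      + u * (1-u)^2 * (344 * (1-v)^2 + 1176 * v * (1-v) + 1648 * v^2)
      + u^2 * (1-u) * (742 * (1-v)^2 + 2290 * v * (1-v) + 1980 * v^2)
      + u^3 * (995 * (1-v)^2 + 1990 * v * (1-v) + 995 * v^2)"
      unfolding B_def P_def Q_def S' X' by (simp add: field_simps power2_eq_square power3_eq_cube)
    also have "\<dots> \<ge> 0"
      by (intro add_nonneg_nonneg mult_nonneg_nonneg zero_le_power rng) (use rng in auto)
    finally show "B + S * X * (P + Q) \<le> 1024" by simp
    \<comment> \<open>The case \<open>t = 0\<close>, where the slack is strictly positive.\<close>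
    have "1024 - (B + S * X * (R + Q / 2)) =
        (1-u)^3 * (448 * (1-v)^2 + 392 * v * (1-v) + 448 * v^2)
      + u * (1-u)^2 * (996 * (1-v)^2 + 2308 * v * (1-v) + 1648 * v^2)
      + u^2 * (1-u) * (1230 * (1-v)^2 + 3426 * v * (1-v) + 1980 * v^2)
      + u^3 * (995 * (1-v)^2 + 1990 * v * (1-v) + 995 * v^2)"
      unfolding B_def R_def Q_def S' X' by (simp add: field_simps power2_eq_square power3_eq_cube)
    also have "\<dots> \<ge> 0"
      by (intro add_nonneg_nonneg mult_nonneg_nonneg zero_le_power rng) (use rng in auto)
    finally show "B + S * X * (R + Q / 2) \<le> 1024" by simp
  qed (use rng in auto)
  finally show ?thesis by simp
qed

text \<open>In Schur parameters the polynomial becomes a sum of monomials whose norms add up to the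
  expression in \<open>real_bound\<close>.\<close>

lemma hankel_schwarz_bound:
  fixes a x y w :: complex and S X Y :: real
  assumes "norm a \<le> 1" "norm x \<le> 1" "norm y \<le> 1" "norm w \<le> 1"
    and S: "S = 1 - norm a ^ 2" and X: "X = 1 - norm x ^ 2" and Y: "Y = 1 - norm y ^ 2"
    and c: "c 1 = a" "c 2 = of_real S * x" "c 3 = of_real S * (of_real X * y - cnj a * x ^ 2)"
    "c 4 = of_real S * (of_real X * (of_real Y * w - cnj x * y ^ 2)
       - 2 * cnj a * x * of_real X * y + cnj a ^ 2 * x ^ 3)"
  shows "norm (29 * c 1 ^ 6 - 116 * c 1 ^ 4 * c 2 + 80 * c 1 ^ 2 * c 2 ^ 2 - 576 * c 2 ^ 3
    + 112 * c 1 ^ 3 * c 3 + 1216 * c 1 * c 2 * c 3 - 1024 * c 3 ^ 2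
    + (1152 * c 2 - 864 * c 1 ^ 2) * c (4::nat)) \<le> 1024"
    (is "norm ?H \<le> _")
proof -
  let ?S = "complex_of_real S" and ?X = "complex_of_real X" and ?Y = "complex_of_real Y"
  have SXY: "0 \<le> S" "0 \<le> X" "0 \<le> Y"
    using assms(1-3) by (auto simp: S X Y power_le_one)
  have pow: "r * r = r ^ 2" "r ^ 3 * r = r ^ 4" "r ^ 2 * r ^ 2 = r ^ 4" for r :: real
    by (simp_all add: eval_nat_numeral)
  \<comment> \<open>An identity of polynomials with \<open>a\<close>, \<open>cnj a\<close>,
    \<open>x\<close>, \<open>cnj x\<close>, \<open>S\<close>, \<open>X\<close>, \<open>Y\<close> as
    independent variables. Like monomials are collected before norms are taken:
    \<open>c 3 ^ 2\<close> and \<open>c 2 * c 4\<close> partly cancel, as in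
    \<open>128 = 1152 - 1024\<close> and \<open>- 256 = 2048 - 2304\<close>. Signs sit in the
    numerals so that only sums and products remain to be estimated.\<close>
  have H: "?H = 29 * a ^ 6 + (- 116) * a ^ 4 * ?S * x
      + (80 * a ^ 2 * ?S ^ 2 + (- 112) * (a ^ 3 * cnj a) * ?S) * x ^ 2
      + ((- 576) * ?S ^ 3 + (- 1216) * (a * cnj a) * ?S ^ 2 + (- 864) * (a ^ 2 * cnj a ^ 2) * ?S) * x ^ 3
      + 128 * cnj a ^ 2 * ?S ^ 2 * x ^ 4
      + ?S * ?X * ((112 * a ^ 3 + (1216 * ?S + 1728 * (a * cnj a)) * (a * x)
          + (- 256) * ?S * cnj a * x ^ 2) * y
        + ((- 1024) * ?S * ?X + (- 1152) * ?S * (x * cnj x) + 864 * a ^ 2 * cnj x) * y ^ 2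
        + (1152 * ?S * x + (- 864) * a ^ 2) * (?Y * w))"
    unfolding c by algebra
  have "norm ?H \<le> 29 * norm a ^ 6 + 116 * norm a ^ 4 * S * norm x
      + (80 * norm a ^ 2 * S ^ 2 + 112 * norm a ^ 4 * S) * norm x ^ 2
      + (576 * S ^ 3 + 1216 * norm a ^ 2 * S ^ 2 + 864 * norm a ^ 4 * S) * norm x ^ 3
      + 128 * norm a ^ 2 * S ^ 2 * norm x ^ 4
      + S * X * ((112 * norm a ^ 3 + (1216 * S + 1728 * norm a ^ 2) * (norm a * norm x)
          + 256 * S * norm a * norm x ^ 2) * norm y
        + (1024 * S * X + 1152 * S * norm x ^ 2 + 864 * norm a ^ 2 * norm x) * norm y ^ 2
        + (1152 * S * norm x + 864 * norm a ^ 2) * Y)"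
    unfolding H
    by (intro norm_triangle_mono norm_mult_ineq[THEN order_trans] mult_mono norm_ge_zero
        mult_nonneg_nonneg add_nonneg_nonneg zero_le_power)
       (use SXY assms(4) in \<open>auto simp: norm_power norm_mult pow mult_left_le\<close>)
  also have "\<dots> \<le> 1024"
    by (rule real_bound[OF norm_ge_zero assms(1) norm_ge_zero assms(2) norm_ge_zero assms(3) S X Y])
  finally show ?thesis .
qed

section \<open>From the Schwarz function to the Hankel determinant\<close>

text \<open>The squared equation avoids expanding the square root, and it is a polynomial identity
  of power series that can be solved recursively for the coefficients of \<open>f\<close>.\<close>

lemma starlike_coeffs:
  assumes f: "f \<in> class_A" and \<omega>: "\<omega> holomorphic_on \<Delta>" "\<omega> 0 = 0"
    and eq: "\<forall>z\<in>\<Delta>. (z * deriv f z) ^ 2 = f z ^ 2 * (1 + \<omega> z)"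
  defines "a \<equiv> taylor_coeff f" and "c \<equiv> fps_nth (fps_expansion \<omega> 0)"
  shows "a 2 = c 1 / 2"
    and "a 3 = c 2 / 4 + c 1 ^ 2 / 16"
    and "a 4 = c 3 / 6 + c 1 * c 2 / 24 + c 1 ^ 3 / 96"
    and "a 5 = c 4 / 8 + c 1 * c 3 / 48 + c 1 ^ 2 * c 2 / 48 - c 1 ^ 4 / 384"
proof -
  define F where "F = fps_expansion f 0"
  define W where "W = fps_expansion \<omega> 0"
  have hol: "f holomorphic_on \<Delta>" and f01: "f 0 = 0" "deriv f 0 = 1"
    using f by (auto simp: class_A_iff)
  have F: "f has_fps_expansion F" and W: "\<omega> has_fps_expansion W"
    using hol \<omega>(1) by (auto simp: F_def W_def intro: has_fps_expansion_disk)
  have FW: "(fps_X * fps_deriv F) ^ 2 = F ^ 2 * (1 + W)"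
    by (rule fps_expansion_eq_disk[OF _ _ eq[rule_format]]) (auto intro!: fps_expansion_intros F W)
  have a01: "fps_nth F 0 = 0" "fps_nth F (Suc 0) = 1"
    using f01 by (auto simp: F_def fps_expansion_def)
  have W0: "fps_nth W 0 = 0"
    using \<omega>(2) by (simp add: W_def fps_expansion_def)
  have nth: "fps_nth F n = a n" "fps_nth W n = c n" for n
    by (simp_all add: F_def a_def taylor_coeff_def W_def c_def)
  note nths = fps_mult_nth power2_eq_square eval_nat_numeral a01 W0 a01[unfolded nth] W0[unfolded nth] nth
  have e: "fps_nth ((fps_X * fps_deriv F) ^ 2) n = fps_nth (F ^ 2 * (1 + W)) n" for n
    by (simp add: FW)
  \<comment> \<open>Since \<open>F\<close> starts with \<open>z\<close>, the coefficient of index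
    \<open>n + 1\<close> is the one that determines \<open>a n\<close>: it contains
    \<open>2 * n * a n\<close> on the left and \<open>2 * a n\<close> on the right, hence the
    divisors \<open>2\<close>, \<open>4\<close>, \<open>6\<close>, \<open>8\<close> below.\<close>
  have "4 * a 2 = 2 * a 2 + c 1"
    using e[of 3] by (simp add: nths algebra_simps)
  then show a2: "a 2 = c 1 / 2"
    by (auto simp: field_simps)
  have a3': "a 3 = (2 * a 2 * c 1 + c 2 - 3 * a 2 ^ 2) / 4"
    using e[of 4] by (simp add: nths field_simps)
  show a3: "a 3 = c 2 / 4 + c 1 ^ 2 / 16"
    unfolding a3' a2 by (simp add: field_simps power2_eq_square)
  have a4': "a 4 = ((2 * a 3 + a 2 ^ 2) * c 1 + 2 * a 2 * c 2 + c 3 - 10 * a 2 * a 3) / 6"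
    using e[of 5] by (simp add: nths field_simps)
  show a4: "a 4 = c 3 / 6 + c 1 * c 2 / 24 + c 1 ^ 3 / 96"
    unfolding a4' a3 a2 by (simp add: field_simps power2_eq_square power3_eq_cube)
  have a5': "a 5 = ((2 * a 4 + 2 * a 2 * a 3) * c 1 + (2 * a 3 + a 2 ^ 2) * c 2 + 2 * a 2 * c 3 + c 4
      - 14 * a 2 * a 4 - 8 * a 3 ^ 2) / 8"
    using e[of 6] by (simp add: nths field_simps)
  show "a 5 = c 4 / 8 + c 1 * c 3 / 48 + c 1 ^ 2 * c 2 / 48 - c 1 ^ 4 / 384"
    unfolding a5' a4 a3 a2 by (simp add: field_simps power2_eq_square power3_eq_cube power4_eq_xxxx)
qed

lemma H_3_1_eq:
  "H_3_1 f = (let a = taylor_coeff f in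
    a 3 * (a 2 * a 4 - (a 3)^2) - a 4 * (a 4 - a 2 * a 3) + a 5 * (a 3 - (a 2)^2))"
  by (simp add: H_3_1_def hankel_matrix_3_1_def det_3 vector_3 Let_def power2_eq_square algebra_simps)

text \<open>Squaring the subordination removes the root. Multiplying by \<open>f z ^ 2\<close> is
  justified off \<open>0\<close> by \<open>class_SL_nonzero\<close>; at \<open>0\<close> both sides
  vanish.\<close>

lemma SL_schwarz:
  assumes "f \<in> class_SL"
  obtains \<omega> where "\<omega> holomorphic_on \<Delta>" "\<omega> 0 = 0" "\<And>z. z \<in> \<Delta> \<Longrightarrow> norm (\<omega> z) < 1"
    "\<forall>z\<in>\<Delta>. (z * deriv f z) ^ 2 = f z ^ 2 * (1 + \<omega> z)"
proof -
  obtain \<omega> where \<omega>: "\<omega> holomorphic_on \<Delta>" "\<omega> 0 = 0" "\<And>z. z \<in> \<Delta> \<Longrightarrow> norm (\<omega> z) < 1"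
    and eq: "\<And>z. z \<in> \<Delta> \<Longrightarrow> log_deriv_quot f z = csqrt (1 + \<omega> z)"
    using assms unfolding class_SL_def subordinate_def by blast
  have "(z * deriv f z) ^ 2 = f z ^ 2 * (1 + \<omega> z)" if z: "z \<in> \<Delta>" for z
  proof (cases "z = 0")
    case True
    then show ?thesis
      using assms by (simp add: class_SL_def class_A_iff)
  next
    case False
    have "(z * deriv f z / f z) ^ 2 = 1 + \<omega> z"
      using eq[OF z] False by (simp add: log_deriv_quot_def)
    then show ?thesis
      using class_SL_nonzero[OF assms z False] by (simp add: field_simps)
  qed
  with \<omega> that show thesis by blast
qed

lemma H_3_1_bound:
  assumes "f \<in> class_SL"
  shows "norm (H_3_1 f) \<le> 1 / 36"
proof -
  obtain \<omega> where \<omega>: "\<omega> holomorphic_on \<Delta>" "\<omega> 0 = 0" "\<And>z. z \<in> \<Delta> \<Longrightarrow> norm (\<omega> z) < 1"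
    and eq: "\<forall>z\<in>\<Delta>. (z * deriv f z) ^ 2 = f z ^ 2 * (1 + \<omega> z)"
    using SL_schwarz[OF assms] by blast
  have f: "f \<in> class_A"
    using assms by (simp add: class_SL_def)
  define c where "c = fps_nth (fps_expansion \<omega> 0)"
  note a = starlike_coeffs[OF f \<omega>(1,2) eq, folded c_def]
  obtain a x y w S X Y where "norm a \<le> 1" "norm x \<le> 1" "norm y \<le> 1" "norm w \<le> 1"
    "S = 1 - norm a ^ 2" "X = 1 - norm x ^ 2" "Y = 1 - norm y ^ 2"
    "c 1 = a" "c 2 = of_real S * x" "c 3 = of_real S * (of_real X * y - cnj a * x ^ 2)"
    "c 4 = of_real S * (of_real X * (of_real Y * w - cnj x * y ^ 2)
       - 2 * cnj a * x * of_real X * y + cnj a ^ 2 * x ^ 3)"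
    using schwarz_coeffs[OF \<omega>] unfolding c_def by metis
  then have "norm (29 * c 1 ^ 6 - 116 * c 1 ^ 4 * c 2 + 80 * c 1 ^ 2 * c 2 ^ 2 - 576 * c 2 ^ 3
    + 112 * c 1 ^ 3 * c 3 + 1216 * c 1 * c 2 * c 3 - 1024 * c 3 ^ 2
    + (1152 * c 2 - 864 * c 1 ^ 2) * c 4) \<le> 1024" (is "norm ?H \<le> _")
    by (rule hankel_schwarz_bound)
  \<comment> \<open>The factor \<open>36864 = 36 * 1024\<close> clears all denominators of the
    coefficient formulas.\<close>
  moreover have "?H = 36864 * H_3_1 f"
    unfolding H_3_1_eq Let_def a by (simp add: field_simps eval_nat_numeral)
  ultimately show ?thesis
    by (simp add: norm_mult)
qed

section \<open>The extremal function\<close>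

text \<open>With \<open>r\<close> the root of \<open>1 + z ^ 3\<close>, solving
  \<open>z f' / f = r\<close> gives \<open>f = z * exp g\<close>, where \<open>g\<close> is the
  primitive of \<open>(r - 1) / z\<close> vanishing at \<open>0\<close>.\<close>

lemma SL_from_schwarz_cube:
  obtains f where "f \<in> class_SL" "\<forall>z\<in>\<Delta>. (z * deriv f z) ^ 2 = f z ^ 2 * (1 + z ^ 3)"
proof -
  define r where "r z = csqrt (1 + z ^ 3)" for z
  \<comment> \<open>This equals \<open>(r z - 1) / z\<close> off \<open>0\<close>, because
    \<open>(r z - 1) * (r z + 1) = z ^ 3\<close>; written this way it has no singularity.\<close>
  define h where "h z = z ^ 2 / (r z + 1)" for z
  have in_dom: "1 + w \<notin> \<real>\<^sub>\<le>\<^sub>0" if "norm w < 1" for w :: complex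
    using that abs_Re_le_cmod[of w] by (auto simp: complex_nonpos_Reals_iff)
  have cube: "norm (z ^ 3) < 1" if "z \<in> \<Delta>" for z :: complex
    using that by (simp add: norm_power power_less_one_iff)
  have r_hol: "r holomorphic_on \<Delta>"
    unfolding r_def by (intro holomorphic_intros) (use in_dom cube in auto)
  have r1: "r z + 1 \<noteq> 0" for z
  proof
    assume "r z + 1 = 0"
    then have "Re (r z) = -1"
      by (simp add: complex_eq_iff)
    then show False
      using Re_csqrt[of "1 + z ^ 3"] by (simp add: r_def)
  qed
  have "h holomorphic_on \<Delta>"
    unfolding h_def by (intro holomorphic_intros r_hol) (use r1 in auto)
  then obtain g where g: "\<And>z. z \<in> \<Delta> \<Longrightarrow> (g has_field_derivative h z) (at z)"
    using holomorphic_convex_primitive'[of \<Delta> h] by (metis at_within_open convex_ball open_ball)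
  \<comment> \<open>Subtracting \<open>g 0\<close> normalises the derivative at \<open>0\<close> to
    \<open>1\<close>.\<close>
  define f where "f z = z * exp (g z - g 0)" for z
  have f': "(f has_field_derivative exp (g z - g 0) * r z) (at z)" if z: "z \<in> \<Delta>" for z
  proof -
    have "z * z ^ 2 = r z ^ 2 - 1"
      unfolding r_def power2_csqrt by (simp add: power2_eq_square power3_eq_cube)
    then have "z * h z = (r z ^ 2 - 1) / (r z + 1)"
      by (simp add: h_def)
    also have "\<dots> = r z - 1"
      using r1[of z] by (simp add: field_simps power2_eq_square)
    finally have "z * h z = r z - 1" .
    then have "exp (g z - g 0) * r z = exp (g z - g 0) + z * (exp (g z - g 0) * h z)"
      by algebra
    moreover have "(f has_field_derivative exp (g z - g 0) + z * (exp (g z - g 0) * h z)) (at z)"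
      unfolding f_def by (rule derivative_eq_intros g z refl | simp)+
    ultimately show ?thesis by simp
  qed
  have deriv_f: "deriv f z = exp (g z - g 0) * r z" if "z \<in> \<Delta>" for z
    using f'[OF that] by (rule DERIV_imp_deriv)
  have "f holomorphic_on \<Delta>"
    unfolding holomorphic_on_open[OF open_ball] using f' by blast
  then have "f \<in> class_A"
    using deriv_f[of 0] by (simp add: class_A_iff f_def r_def)
  have quot: "log_deriv_quot f z = r z" if "z \<in> \<Delta>" for z
    using deriv_f[OF that] by (auto simp: log_deriv_quot_def f_def r_def)
  have "log_deriv_quot f \<prec>\<^sub>s (\<lambda>z. csqrt (1 + z))"
    unfolding subordinate_def
  proof (intro conjI exI[of _ "\<lambda>z. z ^ 3"] ballI)
    show "log_deriv_quot f holomorphic_on \<Delta>"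
      by (rule holomorphic_transform[OF r_hol]) (simp add: quot)
    show "(\<lambda>z. csqrt (1 + z)) holomorphic_on \<Delta>"
      by (intro holomorphic_intros) (use in_dom in auto)
    show "log_deriv_quot f z = csqrt (1 + z ^ 3)" if "z \<in> \<Delta>" for z
      using quot[OF that] by (simp add: r_def)
  qed (use cube in \<open>auto intro!: holomorphic_intros\<close>)
  with \<open>f \<in> class_A\<close> have "f \<in> class_SL"
    by (simp add: class_SL_def)
  moreover have "(z * deriv f z) ^ 2 = f z ^ 2 * (1 + z ^ 3)" if "z \<in> \<Delta>" for z
    unfolding deriv_f[OF that] by (simp add: f_def r_def power_mult_distrib)
  ultimately show thesis
    using that by blast
qed

lemma H_3_1_sharp:
  obtains f where "f \<in> class_SL" "norm (H_3_1 f) = 1 / 36"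
proof -
  obtain f where f: "f \<in> class_SL" "\<forall>z\<in>\<Delta>. (z * deriv f z) ^ 2 = f z ^ 2 * (1 + z ^ 3)"
    using SL_from_schwarz_cube by blast
  have "fps_expansion (\<lambda>z. z ^ 3) (0::complex) = fps_X ^ 3"
    by (rule fps_expansion_eq_disk[OF has_fps_expansion_disk]) (auto intro!: holomorphic_intros fps_expansion_intros)
  then have c: "fps_nth (fps_expansion (\<lambda>z. z ^ 3) (0::complex)) n = (if n = 3 then 1 else 0)" for n
    by simp
  have "f \<in> class_A"
    using f(1) by (simp add: class_SL_def)
  moreover have "(\<lambda>z. z ^ 3) holomorphic_on \<Delta>"
    by (intro holomorphic_intros)
  ultimately have a: "taylor_coeff f 2 = 0" "taylor_coeff f 3 = 0" "taylor_coeff f 4 = 1 / 6"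
    using starlike_coeffs[OF _ _ _ f(2)] by (simp_all add: c)
  \<comment> \<open>Only \<open>- (a 4)^2\<close> survives: the cofactor
    \<open>a 3 - (a 2)^2\<close> of \<open>a 5\<close> is zero.\<close>
  have "H_3_1 f = - (1 / 36)"
    unfolding H_3_1_eq Let_def a by simp
  then show thesis
    using that[OF f(1)] by (simp add: norm_divide)
qed

theorem theorem2p1:
  shows "(\<forall>f\<in>class_SL. let a = taylor_coeff f in
            H_3_1 f = a 3 * (a 2 * a 4 - (a 3)^2) - a 4 * (a 4 - a 2 * a 3) + a 5 * (a 3 - (a 2)^2) \<and>
            norm (H_3_1 f) \<le> 1 / 36) \<and>
         (\<exists>f\<in>class_SL. norm (H_3_1 f) = 1 / 36)"
  using H_3_1_bound H_3_1_sharp by (auto simp: H_3_1_eq Let_def)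

end
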